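(* Let $k\in\mathbb{Z}$ and let $\alpha_1,\alpha_2,\alpha_3,\alpha_4\in\mathbb{C}\setminus\mathbb{Z}$. Then for all $\tau\in\mathbb{H}$ with sufficiently large imaginary part (depending on the $\alpha_i$), with $q=e^{2\pi \sqrt{-1}\,\tau}$ and $\mathrm{e}(x):=e^{2\pi\sqrt{-1}\,x}$, $$\begin{aligned} &\sum_{a,b\in\mathbb{Z}}\frac{(1-\mathrm{e}(\alpha_3+\alpha_4))(1-\mathrm{e}(\alpha_1+\alpha_2)q^{ka})}{(1-\mathrm{e}(\alpha_4)q^a)(1-\mathrm{e}(\alpha_1)q^b)(1-\mathrm{e}(\alpha_3)q^{-a})(1-\mathrm{e}(\alpha_2)q^{ka-b})}\\ =\ &\frac{1}{(2\pi \sqrt{-1})^2}\Big\{\Big(\frac{\theta'(-\alpha_3,\tau)}{\theta(-\alpha_3,\tau)}+\frac{\theta'(-\alpha_4,\tau)}{\theta(-\alpha_4,\tau)}\Big)\Big(\frac{\theta'(-\alpha_1,\tau)}{\theta(-\alpha_1,\tau)}+\frac{\theta'(-\alpha_2,\tau)}{\theta(-\alpha_2,\tau)}\Big)\\ &\quad+\frac{k}{2}\Big(\frac{\theta''(-\alpha_3,\tau)}{\theta(-\alpha_3,\tau)}-\frac{\theta''(-\alpha_4,\tau)}{\theta(-\alpha_4,\tau)}\Big)\Big\}. \end{aligned}$$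
   Context: The Jacobi theta function is $$\theta(z,\tau)=2q^{1/8}\sin(\pi z)\prod_{m=1}^\infty\big[(1-q^m)(1-e^{2\pi \sqrt{-1}\, z}q^m)(1-e^{-2\pi \sqrt{-1}\, z}q^m)\big],\qquad q=e^{2\pi\sqrt{-1}\,\tau},\ q^{1/8}=e^{2\pi\sqrt{-1}\,\tau/8}.$$ Primes denote derivatives with respect to $z$. *)

theory Defs
  imports "HOL-Complex_Analysis.Complex_Analysis"
begin

definition e :: "complex \<Rightarrow> complex" where
  "e x = exp (2 * of_real pi * \<i> * x)"

text \<open>The nome \<open>q\<close> as a function of \<open>\<tau>\<close>. Its eighth root in the theta function is
  \<open>e (\<tau> / 8)\<close>, not a principal-branch root of \<open>q\<close>.\<close>

definition nome :: "complex \<Rightarrow> complex" where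
  "nome \<tau> = e \<tau>"

text \<open>The product over \<open>m \<ge> 1\<close> is indexed from 0 with \<open>m\<close> replaced by \<open>Suc m\<close>. The library's
  infinite product allows finitely many vanishing factors, so the definition is
  also correct at the zeros of theta; it is meaningful for \<open>Im \<tau> > 0\<close>.\<close>

definition theta :: "complex \<Rightarrow> complex \<Rightarrow> complex" where
  "theta z \<tau> = 2 * e (\<tau> / 8) * sin (of_real pi * z) *
     (\<Prod>m. (1 - nome \<tau> ^ Suc m) * (1 - e z * nome \<tau> ^ Suc m) * (1 - e (- z) * nome \<tau> ^ Suc m))"

definition theta' :: "complex \<Rightarrow> complex \<Rightarrow> complex" where
  "theta' z \<tau> = deriv (\<lambda>w. theta w \<tau>) z"

definition theta'' :: "complex \<Rightarrow> complex \<Rightarrow> complex" where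
  "theta'' z \<tau> = deriv (\<lambda>w. theta' w \<tau>) z"

end

(* With x_i = e(alpha_i), the summand factors as F(a) G(k a, b), where both factors are of the form
   1/(1 - x q^b) + 1/(1 - y q^(n - b)) - 1. Subtracting from each 1/(1 - x q^b) its limits 0 and 1 at
   -oo and oo leaves an absolutely convergent series, so the sum over b is A(x_1) + A(x_2) + k a with
   A(x) = lim S_N(x), S_N(x) = sum_{|m| <= N} (1/(1 - x q^m) - 1/2). Summing over a gives
   (A(x_3) + A(x_4)) (A(x_1) + A(x_2)) + k (B(x_4) - B(x_3)), B being the first moment of the same series.

   The N-th partial product of theta has logarithmic derivative 2 pi i S_N(e(-z)); this identifies A with
   theta'/theta, and theta''/theta with (2 pi i)^2 times the limit of S_N^2 - D S_N, D = x d/dx. By partial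
   fractions the off-diagonal terms of S_N^2 become sum_m (1/(1 - x q^m) - 1/2) (-2 m + o(1)), so that
   S_N^2 - D S_N equals -2 B(x) up to a term independent of x. This replaces the heat equation. *)
theory Submission
  imports Defs
begin

section \<open>Unordered sums over the integers\<close>

lemma summable_on_int_abs:
  fixes f :: "nat \<Rightarrow> real"
  assumes "summable f" "\<And>n. f n \<ge> 0"
  shows "(\<lambda>m::int. f (nat \<bar>m\<bar>)) summable_on UNIV"
proof -
  have f: "f summable_on UNIV"
    using assms summable_on_UNIV_nonneg_real_iff by blast
  have "(\<lambda>m. f (nat \<bar>m\<bar>)) summable_on range int"
    by (subst summable_on_reindex) (use f in \<open>auto simp: o_def\<close>)
  moreover have "(\<lambda>m. f (nat \<bar>m\<bar>)) summable_on range (\<lambda>n. - int n)"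
    by (subst summable_on_reindex) (use f in \<open>auto simp: o_def inj_def\<close>)
  moreover have "range int \<union> range (\<lambda>n. - int n) = UNIV"
    by (auto simp: image_iff) (metis int_cases2)
  ultimately show ?thesis
    by (metis summable_on_union)
qed

lemma summable_linear_geometric:
  fixes r :: real
  assumes "0 \<le> r" "r < 1"
  shows "summable (\<lambda>n. (C + D * real n) * r ^ n)"
proof -
  have "summable (\<lambda>n. r ^ n)" using assms by (simp add: summable_geometric)
  moreover have "summable (\<lambda>n. real n * r ^ n)"
  proof -
    have "(\<lambda>n. real (Suc n) * r ^ n) sums (1 / (1 - r)\<^sup>2)"
      using geometric_deriv_sums[of r] assms by simp
    then have "summable (\<lambda>n. (real (Suc n) * r ^ n) - r ^ n)"
      using \<open>summable (\<lambda>n. r ^ n)\<close> by (auto intro: summable_diff sums_summable)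
    then show ?thesis by (simp add: algebra_simps)
  qed
  ultimately have "summable (\<lambda>n. C * r ^ n + D * (real n * r ^ n))"
    by (intro summable_add summable_mult)
  then show ?thesis by (simp add: algebra_simps)
qed

lemma summable_on_int_linear_geometric:
  fixes r :: real
  assumes "0 \<le> r" "r < 1" "C \<ge> 0" "D \<ge> 0"
  shows "(\<lambda>m::int. (C + D * \<bar>of_int m\<bar>) * r ^ nat \<bar>m\<bar>) summable_on UNIV"
  using summable_on_int_abs[OF summable_linear_geometric[OF assms(1,2), of C D]] assms
  by simp

text \<open>Symmetric intervals are cofinal among the finite sets of integers. This turns unordered
  sums into limits along the intervals that index the partial products of theta.\<close>

lemma has_sum_int_LIMSEQ:
  fixes f :: "int \<Rightarrow> 'a :: {comm_monoid_add, topological_space}"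
  assumes "(f has_sum s) UNIV"
  shows "(\<lambda>N. \<Sum>m = - int N..int N. f m) \<longlonglongrightarrow> s"
proof -
  have "filterlim (\<lambda>N. {- int N..int N}) (finite_subsets_at_top UNIV) sequentially"
    unfolding filterlim_finite_subsets_at_top
  proof (intro allI impI)
    fix X :: "int set" assume "finite X \<and> X \<subseteq> UNIV"
    then have "finite X" by simp
    \<comment> \<open>The sum of the absolute values bounds every element of \<open>X\<close>, also
      when \<open>X\<close> is empty.\<close>
    then have X: "X \<subseteq> {- int N..int N}" if "N \<ge> nat (\<Sum>m\<in>X. \<bar>m\<bar>)" for N
    proof -
      have "\<bar>m\<bar> \<le> int N" if "m \<in> X" for m
      proof -
        have "\<bar>m\<bar> \<le> (\<Sum>m\<in>X. \<bar>m\<bar>)" using that \<open>finite X\<close> by (intro member_le_sum) auto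
        then show ?thesis using \<open>N \<ge> nat _\<close> by linarith
      qed
      then show ?thesis by (force simp: abs_le_iff)
    qed
    show "\<forall>\<^sub>F N in sequentially. finite {- int N..int N} \<and> X \<subseteq> {- int N..int N} \<and> {- int N..int N} \<subseteq> UNIV"
      by (rule eventually_mono[OF eventually_ge_at_top[of "nat (\<Sum>m\<in>X. \<bar>m\<bar>)"]])
        (use X in auto)
  qed
  then show ?thesis
    using assms unfolding has_sum_def by (rule filterlim_compose[rotated])
qed

section \<open>Poles on the punctured annulus |q| < |x| < 1/|q|\<close>

locale nome_annulus =
  fixes q x :: complex
  assumes q_nz: "q \<noteq> 0" and x_nz: "x \<noteq> 0" and x_ne_1: "x \<noteq> 1"
    and outer: "norm (x * q) < 1" and inner: "norm (q / x) < 1"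
begin

text \<open>The two quantities bounded by \<open>outer\<close> and \<open>inner\<close> multiply to
  |q|^2.\<close>

lemma norm_q_less_1: "norm q < 1"
proof -
  have "norm (x * q) * norm (q / x) < 1"
    using outer inner mult_strict_mono[of "norm (x*q)" 1 "norm (q/x)" 1] by simp
  then have "norm q * norm q < 1"
    using x_nz by (simp add: norm_mult norm_divide field_simps)
  then show ?thesis
    by (metis abs_norm_cancel abs_square_less_1 power2_eq_square)
qed

end

definition pole :: "complex \<Rightarrow> complex \<Rightarrow> int \<Rightarrow> complex" where
  "pole q x m = 1 / (1 - x * q powi m)"

text \<open>\<open>step\<close> is the limit of \<open>pole q x m\<close> as \<open>m \<rightarrow> \<plusminus>\<infinity>\<close>, so \<open>rest\<close> decays like \<open>\<bar>q\<bar> ^ \<bar>m\<bar>\<close>.\<close>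

definition step :: "int \<Rightarrow> complex" where
  "step m = (if m > 0 then 1 else 0)"

definition rest :: "complex \<Rightarrow> complex \<Rightarrow> int \<Rightarrow> complex" where
  "rest q x m = pole q x m - step m"

context nome_annulus
begin

lemma norm_mult_power_int_pos: 
  assumes "m > 0"
  shows "norm (x * q powi m) \<le> norm (x * q)" "norm (x * q powi m) = norm x * norm q ^ nat \<bar>m\<bar>"
proof -
  show eq: "norm (x * q powi m) = norm x * norm q ^ nat \<bar>m\<bar>"
    using assms by (simp add: norm_mult norm_power power_int_def)
  have "norm q ^ nat \<bar>m\<bar> \<le> norm q ^ 1"
    using norm_q_less_1 assms by (intro power_decreasing) auto
  then show "norm (x * q powi m) \<le> norm (x * q)"
    unfolding eq by (simp add: norm_mult mult_left_mono)
qed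

text \<open>Inversion of x swaps \<open>outer\<close> and \<open>inner\<close>, so facts about
  negative exponents follow from those about positive ones.\<close>

lemma reciprocal: "nome_annulus q (1 / x)"
  using q_nz x_nz x_ne_1 outer inner by unfold_locales (auto simp: norm_divide norm_mult field_simps)

lemma pole_neg:
  assumes "x * q powi m \<noteq> 1"
  shows "pole q x m = - ((1/x) * q powi (-m)) / (1 - (1/x) * q powi (-m))"
proof -
  have "q powi m \<noteq> 0" using q_nz by simp
  then show ?thesis
    using x_nz assms unfolding pole_def
    by (auto simp: power_int_minus divide_simps)
qed

lemma pole_pos:
  assumes "x * q powi m \<noteq> 1"
  shows "pole q x m - 1 = (x * q powi m) / (1 - x * q powi m)"
  using assms unfolding pole_def by (auto simp: divide_simps)

text \<open>For m > 0 the norm of x q^m is at most |x q| < 1; for m < 0 its inverse has norm at most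
  |q / x| < 1; m = 0 is the excluded point x = 1.\<close>

lemma ne_1: "x * q powi m \<noteq> 1"
proof (cases m "0::int" rule: linorder_cases)
  case less
  interpret f: nome_annulus q "1/x" by (rule reciprocal)
  have "norm ((1/x) * q powi (-m)) < 1"
    using f.norm_mult_power_int_pos(1)[of "-m"] f.outer less by linarith
  then have "(1/x) * q powi (-m) \<noteq> 1"
    by fastforce
  then show ?thesis using q_nz x_nz by (auto simp: power_int_minus divide_simps)
next
  case greater
  have "norm (x * q powi m) < 1"
    using norm_mult_power_int_pos(1)[of "m"] outer greater by linarith
  then show ?thesis by fastforce
qed (use x_ne_1 in auto)

lemma rest_bound_pos:
  assumes "m > 0"
  shows "norm (rest q x m) \<le> norm x / (1 - norm (x * q)) * norm q ^ nat \<bar>m\<bar>"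
proof -
  have "1 - norm (x * q) \<le> norm (1 - x * q powi m)"
    using norm_mult_power_int_pos(1)[OF assms] norm_triangle_ineq2[of 1 "x * q powi m"] by simp
  moreover have "norm (rest q x m) = norm (x * q powi m) / norm (1 - x * q powi m)"
    using assms pole_pos[OF ne_1, of m] by (simp add: rest_def step_def norm_divide)
  ultimately have "norm (rest q x m) \<le> norm (x * q powi m) / (1 - norm (x * q))"
    using outer by (simp add: frac_le)
  then show ?thesis using norm_mult_power_int_pos(2)[OF assms] by simp
qed

text \<open>1/(1 - u) = 1 - 1/(1 - 1/u) at u = x q^m, where \<open>step\<close> is 0 at m and 1 at
  -m.\<close>

lemma rest_neg: "m < 0 \<Longrightarrow> rest q x m = - rest q (1/x) (- m)"
  using nome_annulus.pole_pos[OF reciprocal nome_annulus.ne_1[OF reciprocal], of "-m"] pole_neg[OF ne_1, of m]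
  by (simp add: rest_def step_def)

lemma rest_bound: "\<exists>M\<ge>0. \<forall>m. norm (rest q x m) \<le> M * norm q ^ nat \<bar>m\<bar>"
proof -
  interpret f: nome_annulus q "1/x" by (rule reciprocal)
  define M1 where "M1 = norm x / (1 - norm (x * q))"
  define M2 where "M2 = norm (1/x) / (1 - norm ((1/x) * q))"
  define M3 where "M3 = norm (rest q x 0)"
  have pos: "M1 \<ge> 0" "M2 \<ge> 0" "M3 \<ge> 0"
    using outer f.outer unfolding M1_def M2_def M3_def by (auto intro!: divide_nonneg_nonneg)
  have "norm (rest q x m) \<le> (M1 + M2 + M3) * norm q ^ nat \<bar>m\<bar>" for m
  proof (cases m "0::int" rule: linorder_cases)
    case less
    have "norm (rest q x m) \<le> M2 * norm q ^ nat \<bar>m\<bar>"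
      using f.rest_bound_pos[of "-m"] less by (simp add: M2_def rest_neg)
    also have "\<dots> \<le> (M1 + M2 + M3) * norm q ^ nat \<bar>m\<bar>"
      using pos by (intro mult_right_mono) auto
    finally show ?thesis .
  next
    case greater
    have "norm (rest q x m) \<le> M1 * norm q ^ nat \<bar>m\<bar>"
      using rest_bound_pos[of "m"] greater by (simp add: M1_def)
    also have "\<dots> \<le> (M1 + M2 + M3) * norm q ^ nat \<bar>m\<bar>"
      using pos by (intro mult_right_mono) auto
    finally show ?thesis .
  qed (use pos in \<open>simp add: M3_def\<close>)
  then show ?thesis using pos by (intro exI[of _ "M1 + M2 + M3"]) auto
qed

text \<open>The weight is linear because the inner sums over b will grow linearly in a; its special
  cases give the plain sum and the first moment.\<close>

lemma rest_linear_abs_summable: 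
  assumes "C \<ge> 0" "D \<ge> 0"
  shows "(\<lambda>m. (C + D * \<bar>of_int m\<bar>) * norm (rest q x m)) summable_on UNIV"
proof -
  obtain M where M: "M \<ge> 0" "\<And>m. norm (rest q x m) \<le> M * norm q ^ nat \<bar>m\<bar>"
    using rest_bound by blast
  have "(\<lambda>m::int. M * ((C + D * \<bar>of_int m\<bar>) * norm q ^ nat \<bar>m\<bar>)) summable_on UNIV"
    using norm_q_less_1 assms
    by (intro summable_on_cmult_right summable_on_int_linear_geometric) auto
  then show ?thesis
    by (rule summable_on_comparison_test)
      (use mult_left_mono[OF M(2)] assms in \<open>auto simp: mult.left_commute[of M]\<close>)
qed

lemma rest_abs_summable: "(\<lambda>m. norm (rest q x m)) summable_on UNIV"
  using rest_linear_abs_summable[of 1 0] by simp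

lemma rest_summable: "rest q x summable_on UNIV"
  by (rule abs_summable_summable) (rule rest_abs_summable)

lemma rest_moment_abs_summable: "(\<lambda>m. norm (of_int m * rest q x m)) summable_on UNIV"
  using rest_linear_abs_summable[of 0 1] by (simp add: norm_mult)

lemma rest_moment_summable: "(\<lambda>m. of_int m * rest q x m) summable_on UNIV"
  by (rule abs_summable_summable) (rule rest_moment_abs_summable)

end

section \<open>The double series as an iterated sum of pole pairs\<close>

definition rest_sum :: "complex \<Rightarrow> complex \<Rightarrow> complex" where
  "rest_sum q x = (\<Sum>\<^sub>\<infinity>m. rest q x m)"

definition rest_moment :: "complex \<Rightarrow> complex \<Rightarrow> complex" where
  "rest_moment q x = (\<Sum>\<^sub>\<infinity>m. of_int m * rest q x m)"

text \<open>For u = x q^b and v = y q^(n - b) the product u v does not depend on b, and 1/(1 - u) +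
  1/(1 - v) - 1 = (1 - u v)/((1 - u)(1 - v)). Both factors of the summand have this shape, with n =
  0 and n = k a.\<close>

definition pole_pair :: "complex \<Rightarrow> complex \<Rightarrow> complex \<Rightarrow> int \<Rightarrow> int \<Rightarrow> complex" where
  "pole_pair q x y n b = pole q x b + pole q y (n - b) - 1"

lemma (in nome_annulus) rest_has_sum: "(rest q x has_sum rest_sum q x) UNIV"
  unfolding rest_sum_def by (rule has_sum_infsum[OF rest_summable])

lemma (in nome_annulus) rest_moment_has_sum:
  "((\<lambda>m. of_int m * rest q x m) has_sum rest_moment q x) UNIV"
  unfolding rest_moment_def by (rule has_sum_infsum[OF rest_moment_summable])

text \<open>The summand is 1 on \<open>{1..n-1}\<close>, -1 on \<open>{n..0}\<close> and 0
  elsewhere, and at least one of the two intervals is empty. This count is the source of the term k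
  a in the inner sum.\<close>

lemma step_pair_has_sum: "((\<lambda>b. step b + step (n - b) - 1) has_sum (of_int n - 1)) UNIV"
proof (rule has_sum_finite_neutralI[where B = "{1..n-1} \<union> {n..0}"])
  show "of_int n - 1 = (\<Sum>b\<in>{1..n - 1} \<union> {n..0}. step b + step (n - b) - 1)"
  proof (cases "n \<ge> 1")
    case True
    then have "(\<Sum>b\<in>{1..n - 1} \<union> {n..0}. step b + step (n - b) - 1) = (\<Sum>b\<in>{1..n - 1}. 1)"
      by (intro sum.cong) (auto simp: step_def)
    then show ?thesis using True by simp
  next
    case False
    then have "(\<Sum>b\<in>{1..n - 1} \<union> {n..0}. step b + step (n - b) - 1) = (\<Sum>b\<in>{n..0}. -1)"
      by (intro sum.cong) (auto simp: step_def)
    then show ?thesis using False by simp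
  qed
qed (auto simp: step_def)

lemma step_pair_norm_has_sum: "((\<lambda>b. norm (step b + step (n - b) - 1)) has_sum \<bar>of_int n - 1\<bar>) UNIV"
proof (rule has_sum_finite_neutralI[where B = "{1..n-1} \<union> {n..0}"])
  have "(\<Sum>b\<in>{1..n - 1} \<union> {n..0}. norm (step b + step (n - b) - 1)) = (\<Sum>b\<in>{1..n - 1} \<union> {n..0}. 1)"
    by (intro sum.cong) (auto simp: step_def)
  then show "\<bar>of_int n - 1\<bar> = (\<Sum>b\<in>{1..n - 1} \<union> {n..0}. norm (step b + step (n - b) - 1))"
    by (cases "n \<ge> 1") auto
qed (auto simp: step_def)

lemma has_sum_int_reflect:
  fixes n :: int
  shows "(f has_sum s) UNIV \<Longrightarrow> ((\<lambda>b. f (n - b)) has_sum s) UNIV"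
  by (subst has_sum_reindex_bij_witness[of UNIV "\<lambda>b. n - b" "\<lambda>b. n - b" UNIV f]) auto

lemma pole_pair_rest:
  "pole_pair q x y n b = rest q x b + rest q y (n - b) + (step b + step (n - b) - 1)"
  by (simp add: pole_pair_def rest_def)

locale nome_annulus_pair = X: nome_annulus q x + Y: nome_annulus q y for q x y
begin

lemma pole_pair_eq:
  "pole_pair q x y n b = (1 - x * y * q powi n) / ((1 - x * q powi b) * (1 - y * q powi (n - b)))"
proof -
  have "q powi n = q powi b * q powi (n - b)"
    using X.q_nz by (simp flip: power_int_add)
  then show ?thesis
    using X.ne_1[of b] Y.ne_1[of "n - b"] unfolding pole_pair_def pole_def
    by (simp add: divide_simps) (simp add: algebra_simps)
qed

lemma pole_pair_has_sum:
  "(pole_pair q x y n has_sum (rest_sum q x + rest_sum q y + of_int n - 1)) UNIV"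
proof -
  have "((\<lambda>b. rest q x b + rest q y (n - b) + (step b + step (n - b) - 1)) has_sum
      (rest_sum q x + rest_sum q y + (of_int n - 1))) UNIV"
    by (intro has_sum_add X.rest_has_sum has_sum_int_reflect[OF Y.rest_has_sum] step_pair_has_sum)
  then show ?thesis
    by (simp add: pole_pair_rest[abs_def] add_diff_eq)
qed

lemma pole_pair_norm_le:
  "norm (pole_pair q x y n b) \<le> norm (rest q x b) + norm (rest q y (n - b)) + norm (step b + step (n - b) - 1)"
  unfolding pole_pair_rest by (intro norm_triangle_le add_mono order.refl norm_triangle_ineq)

text \<open>The steps make the bound linear in n rather than uniform; the decay of the outer factor
  absorbs this growth in the double sum.\<close>

lemma pole_pair_norm_has_sum:
  obtains s where "((\<lambda>b. norm (pole_pair q x y n b)) has_sum s) UNIV"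
    "0 \<le> s" "s \<le> (\<Sum>\<^sub>\<infinity>m. norm (rest q x m)) + (\<Sum>\<^sub>\<infinity>m. norm (rest q y m)) + \<bar>of_int n - 1\<bar>"
proof -
  have *: "((\<lambda>b. norm (rest q x b) + norm (rest q y (n - b)) + norm (step b + step (n - b) - 1)) has_sum
      (\<Sum>\<^sub>\<infinity>m. norm (rest q x m)) + (\<Sum>\<^sub>\<infinity>m. norm (rest q y m)) + \<bar>of_int n - 1\<bar>) UNIV"
    by (intro has_sum_add step_pair_norm_has_sum has_sum_infsum[OF X.rest_abs_summable]
       has_sum_int_reflect[OF has_sum_infsum[OF Y.rest_abs_summable]])
  then have "(\<lambda>b. norm (pole_pair q x y n b)) summable_on UNIV"
    by (intro summable_on_comparison_test[OF has_sum_imp_summable[OF *]] pole_pair_norm_le) auto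
  then have sm: "((\<lambda>b. norm (pole_pair q x y n b)) has_sum (\<Sum>\<^sub>\<infinity>b. norm (pole_pair q x y n b))) UNIV"
    by (rule has_sum_infsum)
  show thesis
    using has_sum_mono[OF sm * pole_pair_norm_le] infsum_nonneg[of UNIV "\<lambda>b. norm (pole_pair q x y n b)"]
    by (intro that[OF sm]) auto
qed

text \<open>At n = 0 the step part lives only at a = 0, where the weight a kills it. The reflection
  of a gives the moment of y its minus sign.\<close>

lemma pole_pair_moment_has_sum:
  "((\<lambda>a. of_int a * pole_pair q x y 0 a) has_sum (rest_moment q x - rest_moment q y)) UNIV"
proof -
  have "((\<lambda>a. of_int a * rest q x a + - (of_int (0 - a) * rest q y (0 - a))) has_sum
      (rest_moment q x + - rest_moment q y)) UNIV"
    using has_sum_int_reflect[OF Y.rest_moment_has_sum, of 0]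
    by (intro has_sum_add X.rest_moment_has_sum) (simp add: has_sum_uminus del: diff_0 of_int_diff)
  moreover have "of_int a * pole_pair q x y 0 a = of_int a * rest q x a + - (of_int (0 - a) * rest q y (0 - a))" for a
    unfolding pole_pair_rest by (auto simp: step_def algebra_simps)
  ultimately show ?thesis by simp
qed

lemma pole_pair_linear_norm_summable:
  assumes "C \<ge> 0" "D \<ge> 0"
  shows "(\<lambda>a. (C + D * \<bar>of_int a\<bar>) * norm (pole_pair q x y 0 a)) summable_on UNIV"
proof -
  have *: "(\<lambda>a::int. (C + D * \<bar>of_int a\<bar>) * norm (rest q x a)
        + (C + D * \<bar>of_int (0 - a)\<bar>) * norm (rest q y (0 - a))
        + (C + D * \<bar>of_int a\<bar>) * norm (step a + step (0 - a) - 1)) summable_on UNIV"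
    by (intro summable_on_add X.rest_linear_abs_summable
       has_sum_imp_summable[OF has_sum_int_reflect[OF has_sum_infsum[OF Y.rest_linear_abs_summable]]] assms
       has_sum_imp_summable[OF has_sum_finite_neutralI[where B = "{0}", OF _ _ _ refl]]) (auto simp: step_def)
  show ?thesis
    by (rule summable_on_comparison_test[OF *])
      (use assms mult_left_mono[OF pole_pair_norm_le[of 0]] in \<open>auto simp flip: distrib_left\<close>)
qed

end

text \<open>The norms over b sum to O(1 + |a|) while the factor in a decays geometrically. Hence the
  family is absolutely summable over all pairs, and summing over b first is legitimate.\<close>

lemma pole_pair_double_sum:
  assumes "nome_annulus_pair q u v" "nome_annulus_pair q x y"
  shows "((\<lambda>(a, b). pole_pair q u v 0 a * pole_pair q x y (k * a) b) has_sum
    ((rest_sum q u + rest_sum q v - 1) * (rest_sum q x + rest_sum q y - 1)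
     + of_int k * (rest_moment q u - rest_moment q v))) UNIV"
proof -
  interpret U: nome_annulus_pair q u v by fact
  interpret X: nome_annulus_pair q x y by fact
  \<comment> \<open>The final 1 absorbs the shift in |k a - 1| <= |k| |a| + 1.\<close>
  define C where "C = (\<Sum>\<^sub>\<infinity>m. norm (rest q x m)) + (\<Sum>\<^sub>\<infinity>m. norm (rest q y m)) + 1"
  have "C \<ge> 0" unfolding C_def by (intro add_nonneg_nonneg infsum_nonneg) auto
  have "\<forall>a. \<exists>s. ((\<lambda>b. norm (pole_pair q x y (k * a) b)) has_sum s) UNIV \<and> 0 \<le> s \<and> s \<le> C + \<bar>of_int k\<bar> * \<bar>of_int a\<bar>"
  proof
    fix a
    obtain s where s: "((\<lambda>b. norm (pole_pair q x y (k * a) b)) has_sum s) UNIV" "0 \<le> s"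
      "s \<le> (\<Sum>\<^sub>\<infinity>m. norm (rest q x m)) + (\<Sum>\<^sub>\<infinity>m. norm (rest q y m)) + \<bar>of_int (k * a) - 1\<bar>"
      using X.pole_pair_norm_has_sum by blast
    have "\<bar>of_int (k * a) - 1\<bar> \<le> \<bar>of_int k\<bar> * \<bar>of_int a :: real\<bar> + 1"
      using abs_triangle_ineq4[of "of_int k * of_int a" "1::real"] by (simp add: abs_mult)
    with s show "\<exists>s. ((\<lambda>b. norm (pole_pair q x y (k * a) b)) has_sum s) UNIV \<and> 0 \<le> s \<and> s \<le> C + \<bar>of_int k\<bar> * \<bar>of_int a\<bar>"
      unfolding C_def by (intro exI[of _ s]) auto
  qed
  then obtain s where s: "\<And>a. ((\<lambda>b. norm (pole_pair q x y (k * a) b)) has_sum s a) UNIV"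
      "\<And>a. 0 \<le> s a" "\<And>a. s a \<le> C + \<bar>of_int k\<bar> * \<bar>of_int a\<bar>"
    by metis
  let ?f = "\<lambda>(a, b). pole_pair q u v 0 a * pole_pair q x y (k * a) b"
  have "(\<lambda>p. norm (?f p)) summable_on (SIGMA a:UNIV. UNIV)"
  proof (rule summable_on_SigmaI[where g = "\<lambda>a. norm (pole_pair q u v 0 a) * s a"])
    show "((\<lambda>b. norm (?f (a, b))) has_sum norm (pole_pair q u v 0 a) * s a) UNIV" for a
      using has_sum_cmult_right[OF s(1)] by (simp add: norm_mult)
    show "(\<lambda>a. norm (pole_pair q u v 0 a) * s a) summable_on UNIV"
    proof (rule summable_on_comparison_test[OF U.pole_pair_linear_norm_summable])
      show "norm (pole_pair q u v 0 a) * s a \<le> (C + \<bar>of_int k\<bar> * \<bar>of_int a\<bar>) * norm (pole_pair q u v 0 a)" for a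
        by (subst mult.commute) (intro mult_right_mono s norm_ge_zero)
    qed (use \<open>C \<ge> 0\<close> s in auto)
  qed auto
  then have summable: "?f summable_on (SIGMA a:UNIV. UNIV)"
    by (rule abs_summable_summable)
  have "(?f has_sum ((rest_sum q x + rest_sum q y - 1) * (rest_sum q u + rest_sum q v + of_int 0 - 1)
     + of_int k * (rest_moment q u - rest_moment q v))) (SIGMA a:UNIV. UNIV)"
  proof (rule has_sum_SigmaI[OF _ _ summable])
    show "((\<lambda>b. ?f (a, b)) has_sum pole_pair q u v 0 a * (rest_sum q x + rest_sum q y + of_int (k * a) - 1)) UNIV" for a
      using has_sum_cmult_right[OF X.pole_pair_has_sum[of "k * a"], of "pole_pair q u v 0 a"] by simp
    \<comment> \<open>The inner sum is affine in a: its constant part multiplies the plain sum over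
      a, its part k a produces the first moment.\<close>
    have "((\<lambda>a. (rest_sum q x + rest_sum q y - 1) * pole_pair q u v 0 a
        + of_int k * (of_int a * pole_pair q u v 0 a)) has_sum
       ((rest_sum q x + rest_sum q y - 1) * (rest_sum q u + rest_sum q v + of_int 0 - 1)
        + of_int k * (rest_moment q u - rest_moment q v))) UNIV"
      by (intro has_sum_add has_sum_cmult_right U.pole_pair_has_sum U.pole_pair_moment_has_sum)
    then show "((\<lambda>a. pole_pair q u v 0 a * (rest_sum q x + rest_sum q y + of_int (k * a) - 1)) has_sum
       ((rest_sum q x + rest_sum q y - 1) * (rest_sum q u + rest_sum q v + of_int 0 - 1)
        + of_int k * (rest_moment q u - rest_moment q v))) UNIV"
      by (simp add: algebra_simps)
  qed
  then show ?thesis by (simp add: mult.commute)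
qed

section \<open>The square of the symmetric pole sum\<close>

text \<open>The value \<open>0\<close> at \<open>d = 0\<close> makes the function odd, so that double sums over all pairs, including
  the diagonal, can be rearranged freely.\<close>

definition odd_pole :: "complex \<Rightarrow> int \<Rightarrow> complex" where
  "odd_pole q d = (if d = 0 then 0 else 1 / (1 - q powi d) - 1 / 2)"

text \<open>Twice this is the coefficient of \<open>pole q x m - 1 / 2\<close> in the off-diagonal
  part of the square of \<open>pole_sum q x N\<close>; it is free of x.\<close>

definition odd_pole_sum :: "complex \<Rightarrow> nat \<Rightarrow> int \<Rightarrow> complex" where
  "odd_pole_sum q N m = (\<Sum>n = - int N..int N. odd_pole q (n - m))"

text \<open>At x = e(-z) this is the logarithmic derivative of the N-th partial theta product,
  divided by 2 pi i.\<close>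

definition pole_sum :: "complex \<Rightarrow> complex \<Rightarrow> nat \<Rightarrow> complex" where
  "pole_sum q x N = (\<Sum>m = - int N..int N. pole q x m - 1 / 2)"

text \<open>Applying x d/dx to 1/(1 - x p) gives x p/(1 - x p)^2, which is the square of that
  fraction minus the fraction. So this is x d/dx of \<open>pole_sum\<close>.\<close>

definition pole_deriv_sum :: "complex \<Rightarrow> complex \<Rightarrow> nat \<Rightarrow> complex" where
  "pole_deriv_sum q x N = (\<Sum>m = - int N..int N. (pole q x m)\<^sup>2 - pole q x m)"

lemma power_int_ne_1:
  fixes q :: complex
  assumes "q \<noteq> 0" "norm q < 1" "d \<noteq> 0"
  shows "q powi d \<noteq> 1"
proof -
  have pos: "q powi d \<noteq> 1" if "d > 0" for d
  proof -
    have "norm (q powi d) = norm q ^ nat d" using that by (simp add: power_int_def norm_power)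
    also have "\<dots> < 1" using assms that by (simp add: power_less_one_iff)
    finally show ?thesis by auto
  qed
  show ?thesis
    using pos[of d] pos[of "- d"] assms by (cases "d > 0") (auto simp: power_int_minus)
qed

lemma odd_pole_minus:
  assumes "q \<noteq> 0" "norm q < 1"
  shows "odd_pole q (- d) = - odd_pole q d"
  using power_int_ne_1[OF assms, of d] assms
  by (auto simp: odd_pole_def power_int_minus divide_simps) (auto simp: algebra_simps)

lemma odd_pole_pos_bound:
  assumes "q \<noteq> 0" "norm q < 1" "d > 0"
  shows "norm (odd_pole q d - 1 / 2) \<le> norm q ^ nat d / (1 - norm q)"
proof -
  have n: "norm (q powi d) = norm q ^ nat d" using assms by (simp add: power_int_def norm_power)
  have "norm q ^ nat d \<le> norm q ^ 1" using assms by (intro power_decreasing) auto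
  then have "1 - norm q \<le> norm (1 - q powi d)"
    using norm_triangle_ineq2[of 1 "q powi d"] n by simp
  moreover have "odd_pole q d - 1 / 2 = q powi d / (1 - q powi d)"
    using power_int_ne_1[OF assms(1,2), of d] assms(3) by (simp add: odd_pole_def divide_simps)
  ultimately show ?thesis
    using assms n by (simp add: norm_divide frac_le)
qed

lemma odd_pole_sum_minus:
  assumes "q \<noteq> 0" "norm q < 1"
  shows "odd_pole_sum q N (- m) = - odd_pole_sum q N m"
  unfolding odd_pole_sum_def sum_negf[symmetric]
  by (rule sum.reindex_bij_witness[of _ uminus uminus]) 
    (auto simp: add.commute simp flip: odd_pole_minus[OF assms])

text \<open>By oddness the centred part of the shifted window cancels. The 2 m remaining terms have
  arguments at most -(N - m + 1) and are close to -1/2, hence the main term -m; the argument nearest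
  to 0 governs the error.\<close>

lemma odd_pole_sum_approx_nonneg:
  assumes q: "q \<noteq> 0" "norm q < 1" and m: "0 \<le> m" "m \<le> int N"
  shows "norm (odd_pole_sum q N m + of_int m) \<le> 2 * real N * (norm q ^ (N - nat m) / (1 - norm q))"
proof -
  \<comment> \<open>The absolute values of the 2 m uncancelled arguments.\<close>
  let ?I = "{int N - m + 1..int N + m}"
  have sym: "(\<Sum>d = - K..K. odd_pole q d) = 0" for K
  proof -
    have "(\<Sum>d = - K..K. odd_pole q d) = (\<Sum>d = - K..K. - odd_pole q d)"
      by (rule sum.reindex_bij_witness[of _ uminus uminus]) (auto simp: odd_pole_minus[OF q])
    then show ?thesis by (simp add: sum_negf)
  qed
  have "odd_pole_sum q N m = (\<Sum>d = - int N - m..int N - m. odd_pole q d)"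
    unfolding odd_pole_sum_def
    by (rule sum.reindex_bij_witness[of _ "\<lambda>d. d + m" "\<lambda>n. n - m"]) auto
  also have "\<dots> = (\<Sum>d \<in> {- (int N + m)..- (int N - m + 1)} \<union> {- (int N - m)..int N - m}. odd_pole q d)"
    using m by (intro sum.cong) auto
  also have "\<dots> = (\<Sum>d = - (int N + m)..- (int N - m + 1). odd_pole q d)"
    by (subst sum.union_disjoint) (auto simp del: minus_diff_eq minus_add_distrib simp: sym)
  also have "\<dots> = (\<Sum>d\<in>?I. - odd_pole q d)"
    by (rule sum.reindex_bij_witness[of _ uminus uminus]) (auto simp: odd_pole_minus[OF q])
  finally have "odd_pole_sum q N m + of_int m = (\<Sum>d\<in>?I. - (odd_pole q d - 1 / 2))"
    using m by (simp add: sum_negf sum_subtractf)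
  also have "norm \<dots> \<le> (\<Sum>d\<in>?I. norm q ^ (N - nat m) / (1 - norm q))"
  proof (rule sum_norm_le)
    fix d assume d: "d \<in> ?I"
    have "norm (odd_pole q d - 1 / 2) \<le> norm q ^ nat d / (1 - norm q)"
      using d m by (intro odd_pole_pos_bound q) auto
    also have "\<dots> \<le> norm q ^ (N - nat m) / (1 - norm q)"
      using d m q by (intro divide_right_mono power_decreasing) auto
    finally show "norm (- (odd_pole q d - 1 / 2)) \<le> norm q ^ (N - nat m) / (1 - norm q)"
      by (simp only: norm_minus_cancel)
  qed
  also have "\<dots> = 2 * of_int m * (norm q ^ (N - nat m) / (1 - norm q))"
    using m by simp
  also have "\<dots> \<le> 2 * real N * (norm q ^ (N - nat m) / (1 - norm q))"
    using m q by (intro mult_right_mono) auto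
  finally show ?thesis .
qed

lemma odd_pole_sum_approx:
  assumes q: "q \<noteq> 0" "norm q < 1" and m: "\<bar>m\<bar> \<le> int N"
  shows "norm (odd_pole_sum q N m + of_int m) \<le> 2 * real N * (norm q ^ (N - nat \<bar>m\<bar>) / (1 - norm q))"
proof (cases "m \<ge> 0")
  case True
  then show ?thesis using odd_pole_sum_approx_nonneg[OF q, of m N] m by simp
next
  case False
  have "odd_pole_sum q N m + of_int m = - (odd_pole_sum q N (- m) + of_int (- m))"
    by (simp add: odd_pole_sum_minus[OF q])
  with False m odd_pole_sum_approx_nonneg[OF q, of "-m" N] show ?thesis
    by (simp only: norm_minus_cancel) simp
qed

context nome_annulus
begin

text \<open>The addition theorem of the cotangent, in terms of \<open>1 / (1 - x) - 1 / 2\<close>.\<close>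

lemma pole_mult:
  "(pole q x m - 1 / 2) * (pole q x n - 1 / 2) =
    odd_pole q (n - m) * (pole q x m - 1 / 2) + odd_pole q (m - n) * (pole q x n - 1 / 2) + 1 / 4
    + (if n = m then (pole q x m)\<^sup>2 - pole q x m else 0)"
proof (cases "n = m")
  case True
  then show ?thesis by (simp add: odd_pole_def power2_eq_square algebra_simps)
next
  case False
  define p s where "p = q powi m" and "s = q powi (n - m)"
  have qn: "q powi n = p * s" using q_nz by (simp add: p_def s_def flip: power_int_add)
  have "s \<noteq> 1" using False power_int_ne_1[OF q_nz norm_q_less_1, of "n - m"] by (simp add: s_def)
  moreover have "x * p \<noteq> 1" "x * (p * s) \<noteq> 1"
    using ne_1[of m] ne_1[of n] qn by (simp_all add: p_def)
  ultimately have "(1 / (1 - x * p) - 1 / 2) * (1 / (1 - x * (p * s)) - 1 / 2) =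
      (1 / (1 - s) - 1 / 2) * (1 / (1 - x * p) - 1 / 2)
      + (1 / 2 - 1 / (1 - s)) * (1 / (1 - x * (p * s)) - 1 / 2) + 1 / 4"
    by (simp add: divide_simps) (simp add: algebra_simps)
  moreover have "odd_pole q (n - m) = 1 / (1 - s) - 1 / 2"
    using False by (simp add: odd_pole_def s_def)
  moreover have "odd_pole q (m - n) = - odd_pole q (n - m)"
    using odd_pole_minus[OF q_nz norm_q_less_1, of "n - m"] by simp
  ultimately show ?thesis
    using False by (simp add: pole_def qn flip: p_def)
qed

text \<open>After expansion by \<open>pole_mult\<close>, the two sums with \<open>odd_pole\<close>
  agree by exchanging m and n, the constant 1/4 occurs for (2 N + 1)^2 pairs, and the diagonal
  supplies \<open>pole_deriv_sum\<close>.\<close>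

lemma pole_sum_square:
  "(pole_sum q x N)\<^sup>2 = pole_deriv_sum q x N + (2 * of_nat N + 1)\<^sup>2 / 4
    + 2 * (\<Sum>m = - int N..int N. odd_pole_sum q N m * (pole q x m - 1 / 2))"
proof -
  let ?I = "{- int N..int N}" and ?h = "\<lambda>m. pole q x m - 1 / 2"
  have "(pole_sum q x N)\<^sup>2 = (\<Sum>m\<in>?I. \<Sum>n\<in>?I. ?h m * ?h n)"
    by (simp only: pole_sum_def power2_eq_square sum_product)
  also have "\<dots> = (\<Sum>m\<in>?I. \<Sum>n\<in>?I. odd_pole q (n - m) * ?h m) + (\<Sum>m\<in>?I. \<Sum>n\<in>?I. odd_pole q (m - n) * ?h n)
     + (\<Sum>m\<in>?I. \<Sum>n\<in>?I. 1 / 4) + (\<Sum>m\<in>?I. \<Sum>n\<in>?I. if n = m then (pole q x m)\<^sup>2 - pole q x m else 0)"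
    unfolding pole_mult sum.distrib ..
  also have "(\<Sum>m\<in>?I. \<Sum>n\<in>?I. odd_pole q (n - m) * ?h m) = (\<Sum>m\<in>?I. odd_pole_sum q N m * ?h m)"
    by (simp only: odd_pole_sum_def sum_distrib_right)
  also have "(\<Sum>m\<in>?I. \<Sum>n\<in>?I. odd_pole q (m - n) * ?h n) = (\<Sum>m\<in>?I. odd_pole_sum q N m * ?h m)"
    by (subst sum.swap) (simp only: odd_pole_sum_def sum_distrib_right)
  also have "(\<Sum>m\<in>?I. \<Sum>n\<in>?I. if n = m then (pole q x m)\<^sup>2 - pole q x m else 0) = pole_deriv_sum q x N"
    unfolding pole_deriv_sum_def by (intro sum.cong) auto
  also have "(\<Sum>m\<in>?I. \<Sum>n\<in>?I. 1 / 4) = (2 * of_nat N + 1 :: complex)\<^sup>2 / 4"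
    by (simp add: power2_eq_square)
  finally show ?thesis by simp
qed

lemma pole_sum_LIMSEQ:
  assumes "(rest q x has_sum s) UNIV"
  shows "pole_sum q x \<longlonglongrightarrow> s - 1 / 2"
proof -
  \<comment> \<open>Of the 2 N + 1 indices exactly N are positive, so the sum is N - (2 N + 1)/2.
    This is the origin of the shift by 1/2.\<close>
  have step: "(\<Sum>m = - int N..int N. step m - 1 / 2) = - 1 / 2" for N
  proof -
    have "(\<Sum>m = - int N..int N. step m) = (\<Sum>m \<in> {1..int N}. 1)"
      by (intro sum.mono_neutral_cong_right) (auto simp: step_def)
    then show ?thesis by (simp add: sum_subtractf) (simp add: field_simps)
  qed
  have "pole_sum q x = (\<lambda>N. (\<Sum>m = - int N..int N. rest q x m) - 1 / 2)"
  proof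
    fix N
    have "pole_sum q x N = (\<Sum>m = - int N..int N. rest q x m + (step m - 1 / 2))"
      by (simp add: pole_sum_def rest_def)
    then show "pole_sum q x N = (\<Sum>m = - int N..int N. rest q x m) - 1 / 2"
      unfolding sum.distrib step by simp
  qed
  then show ?thesis
    using tendsto_diff[OF has_sum_int_LIMSEQ[OF assms] tendsto_const] by simp
qed

text \<open>Near |m| = N the approximation of \<open>odd_pole_sum\<close> by -m is poor, but there
  \<open>rest\<close> is tiny. The bounds |q|^(N - |m|) and |q|^|m| multiply to |q|^N for every m,
  so the whole sum is O(N^2 |q|^N).\<close>

lemma odd_pole_sum_rest_LIMSEQ:
  "(\<lambda>N. \<Sum>m = - int N..int N. (odd_pole_sum q N m + of_int m) * rest q x m) \<longlonglongrightarrow> 0"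
proof -
  obtain M where M: "M \<ge> 0" "\<And>m. norm (rest q x m) \<le> M * norm q ^ nat \<bar>m\<bar>"
    using rest_bound by blast
  define c where "c = 2 * M / (1 - norm q)"
  have bound: "norm (\<Sum>m = - int N..int N. (odd_pole_sum q N m + of_int m) * rest q x m)
     \<le> c * ((2 * real N + 1) * real N * norm q ^ N)" for N
  proof -
    have "norm (\<Sum>m = - int N..int N. (odd_pole_sum q N m + of_int m) * rest q x m)
     \<le> (\<Sum>m = - int N..int N. c * real N * norm q ^ N)"
    proof (rule sum_norm_le)
      fix m assume "m \<in> {- int N..int N}"
      then have m: "\<bar>m\<bar> \<le> int N" by auto
      have "norm ((odd_pole_sum q N m + of_int m) * rest q x m)
        \<le> (2 * real N * (norm q ^ (N - nat \<bar>m\<bar>) / (1 - norm q))) * (M * norm q ^ nat \<bar>m\<bar>)"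
        unfolding norm_mult using norm_q_less_1
        by (intro mult_mono odd_pole_sum_approx q_nz m M) auto
      also have "\<dots> = c * real N * (norm q ^ (N - nat \<bar>m\<bar>) * norm q ^ nat \<bar>m\<bar>)"
        by (simp add: c_def)
      also have "\<dots> = c * real N * norm q ^ N"
        using m by (simp flip: power_add)
      finally show "norm ((odd_pole_sum q N m + of_int m) * rest q x m) \<le> c * real N * norm q ^ N" .
    qed
    then show ?thesis by (simp add: algebra_simps)
  qed
  have lim: "(\<lambda>N. c * ((2 * real N + 1) * real N * norm q ^ N)) \<longlonglongrightarrow> 0"
  proof -
    \<comment> \<open>With t^2 = |q| the term N^2 |q|^N becomes (N t^N)^2, the square of a null
      sequence.\<close>
    define t where "t = sqrt (norm q)"
    have t: "norm t < 1" "norm q = t\<^sup>2"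
      using norm_q_less_1 by (simp_all add: t_def)
    have "(\<lambda>N. 2 * (real N * t ^ N)\<^sup>2 + real N * norm q ^ N) \<longlonglongrightarrow> 2 * 0\<^sup>2 + 0"
      using norm_q_less_1 t(1) by (intro tendsto_intros powser_times_n_limit_0) auto
    moreover have "2 * (real N * t ^ N)\<^sup>2 + real N * norm q ^ N = (2 * real N + 1) * real N * norm q ^ N" for N
      unfolding t(2) by (simp add: power2_eq_square algebra_simps power_mult_distrib)
    ultimately have "(\<lambda>N. (2 * real N + 1) * real N * norm q ^ N) \<longlonglongrightarrow> 0"
      by simp
    then show ?thesis by (rule tendsto_mult_right_zero)
  qed
  show ?thesis
    by (rule Lim_null_comparison[OF _ lim]) (simp add: bound)
qed

end

text \<open>A divergent quantity whose only relevant feature is that it does not depend on \<open>x\<close>: it cancels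
  in the difference of \<open>\<theta>''/\<theta>\<close> at two points.\<close>

definition pole_norm_const :: "complex \<Rightarrow> nat \<Rightarrow> complex" where
  "pole_norm_const q N = (2 * of_nat N + 1)\<^sup>2 / 4
    + 2 * (\<Sum>m = - int N..int N. odd_pole_sum q N m * (step m - 1 / 2))"

text \<open>Splitting \<open>pole - 1/2\<close> into \<open>rest\<close> and
  \<open>step - 1/2\<close> puts the divergence into \<open>pole_norm_const\<close>. On the
  \<open>rest\<close> part \<open>odd_pole_sum\<close> acts like -m in the limit.\<close>

lemma (in nome_annulus) pole_sum_square_LIMSEQ:
  assumes "((\<lambda>m. of_int m * rest q x m) has_sum s) UNIV"
  shows "(\<lambda>N. (pole_sum q x N)\<^sup>2 - pole_deriv_sum q x N - pole_norm_const q N) \<longlonglongrightarrow> - 2 * s"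
proof -
  have "(pole_sum q x N)\<^sup>2 - pole_deriv_sum q x N - pole_norm_const q N
    = 2 * (\<Sum>m = - int N..int N. (odd_pole_sum q N m + of_int m) * rest q x m)
      - 2 * (\<Sum>m = - int N..int N. of_int m * rest q x m)" for N
    unfolding pole_sum_square pole_norm_const_def rest_def
    by (simp add: algebra_simps sum.distrib sum_subtractf)
  moreover have "(\<lambda>N. 2 * (\<Sum>m = - int N..int N. (odd_pole_sum q N m + of_int m) * rest q x m)
      - 2 * (\<Sum>m = - int N..int N. of_int m * rest q x m)) \<longlonglongrightarrow> 2 * 0 - 2 * s"
    by (intro tendsto_intros odd_pole_sum_rest_LIMSEQ has_sum_int_LIMSEQ assms)
  ultimately show ?thesis by simp
qed

section \<open>The theta product and its partial products\<close>

lemma e_add: "e (x + y) = e x * e y"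
  by (simp add: e_def distrib_left exp_add)

lemma e_minus: "e (- x) = 1 / e x"
  by (simp add: e_def exp_minus field_simps)

lemma e_nz [simp]: "e x \<noteq> 0"
  by (simp add: e_def)

lemma norm_e: "norm (e x) = exp (- 2 * pi * Im x)"
  by (simp add: e_def norm_exp_eq_Re)

lemma e_eq_1_iff: "e x = 1 \<longleftrightarrow> x \<in> \<int>"
proof
  assume "e x = 1"
  then obtain n :: int where n: "2 * pi * Im x = 0" "2 * pi * Re x = of_int (2 * n) * pi"
    unfolding e_def exp_eq_1 by auto
  then have "x = of_int n" by (auto simp: complex_eq_iff)
  then show "x \<in> \<int>" by simp
next
  assume "x \<in> \<int>"
  then obtain n where "x = of_int n" by (auto elim: Ints_cases)
  then show "e x = 1" unfolding e_def exp_eq_1 by (auto intro!: exI[of _ n])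
qed

lemma e_has_field_derivative [derivative_intros]:
  assumes "(f has_field_derivative f') (at z within A)"
  shows "((\<lambda>z. e (f z)) has_field_derivative (2 * of_real pi * \<i> * f' * e (f z))) (at z within A)"
  unfolding e_def by (auto intro!: derivative_eq_intros assms)

lemma continuous_on_e [continuous_intros]:
  "continuous_on A f \<Longrightarrow> continuous_on A (\<lambda>z. e (f z))"
  unfolding e_def by (intro continuous_intros)

definition theta_factor :: "complex \<Rightarrow> nat \<Rightarrow> complex \<Rightarrow> complex" where
  "theta_factor q m z = (1 - q ^ Suc m) * (1 - e z * q ^ Suc m) * (1 - e (- z) * q ^ Suc m)"

text \<open>The sine belongs to every partial product, since it supplies the m = 0 term of the
  logarithmic derivative.\<close>

definition theta_partial :: "complex \<Rightarrow> nat \<Rightarrow> complex \<Rightarrow> complex" where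
  "theta_partial \<tau> N z = 2 * e (\<tau> / 8) * sin (of_real pi * z) * (\<Prod>m<N. theta_factor (e \<tau>) m z)"

lemma theta_eq:
  "theta z \<tau> = 2 * e (\<tau> / 8) * sin (of_real pi * z) * (\<Prod>m. theta_factor (e \<tau>) m z)"
  by (simp add: theta_def theta_factor_def nome_def)

text \<open>A telescoping expansion: each summand contains one of A, B, C, and its other factors
  have norm at most 1 + E.\<close>

lemma norm_prod3_minus_1_le:
  fixes A B C :: complex
  assumes "norm A \<le> a" "norm B \<le> a" "norm C \<le> a" "a \<le> E"
  shows "norm ((1 - A) * (1 - B) * (1 - C) - 1) \<le> a * ((1 + E)\<^sup>2 + (1 + E) + 1)"
proof -
  have a: "0 \<le> a" using assms(1) norm_ge_zero order_trans by blast
  have n: "norm (1 - X) \<le> 1 + E" if "norm X \<le> a" for X :: complex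
    using norm_triangle_ineq4[of 1 X] that assms(4) by simp
  have "(1 - A) * (1 - B) * (1 - C) - 1 = - (A * ((1 - B) * (1 - C)) + B * (1 - C) + C)"
    by (simp add: algebra_simps)
  then have "norm ((1 - A) * (1 - B) * (1 - C) - 1) = norm (A * ((1 - B) * (1 - C)) + B * (1 - C) + C)"
    by (simp only: norm_minus_cancel)
  also have "\<dots> \<le> norm (A * ((1 - B) * (1 - C))) + norm (B * (1 - C)) + norm C"
    by (intro norm_triangle_le add_mono order.refl norm_triangle_ineq)
  also have "\<dots> \<le> a * ((1 + E) * (1 + E)) + a * (1 + E) + a"
    unfolding norm_mult using a assms by (intro add_mono mult_mono n) auto
  finally show ?thesis by (simp add: power2_eq_square algebra_simps)
qed

text \<open>The bound is geometric in m and depends on z only through E, as a uniform majorant on a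
  disc requires.\<close>

lemma theta_factor_bound:
  assumes "norm q < 1" "norm (e z) \<le> E" "norm (e (- z)) \<le> E" "1 \<le> E"
  shows "norm (theta_factor q m z - 1) \<le> E * ((1 + E)\<^sup>2 + (1 + E) + 1) * norm q ^ m"
proof -
  have qm: "norm (q ^ Suc m) \<le> norm q ^ m"
    using assms(1) by (simp add: norm_mult norm_power mult_left_le_one_le)
  have b: "norm (X * q ^ Suc m) \<le> E * norm q ^ m" if "norm X \<le> E" for X
    unfolding norm_mult using qm that assms(4) by (intro mult_mono) auto
  have "norm (theta_factor q m z - 1) \<le> (E * norm q ^ m) * ((1 + E)\<^sup>2 + (1 + E) + 1)"
    unfolding theta_factor_def
  proof (rule norm_prod3_minus_1_le)
    show "norm (q ^ Suc m) \<le> E * norm q ^ m" using b[of 1] assms(4) by simp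
    show "E * norm q ^ m \<le> E"
      using assms by (simp add: mult_left_le power_le_one)
  qed (use b assms in auto)
  then show ?thesis by (simp add: mult_ac)
qed

lemma theta_factor_convergent_prod:
  assumes "norm q < 1"
  shows "convergent_prod (\<lambda>m. theta_factor q m z)"
proof -
  define E where "E = 1 + norm (e z) + norm (e (- z))"
  have "summable (\<lambda>m. E * ((1 + E)\<^sup>2 + (1 + E) + 1) * norm q ^ m)"
    using assms by (intro summable_mult summable_geometric) auto
  then have "summable (\<lambda>m. norm (theta_factor q m z - 1))"
    by (rule summable_comparison_test'[where N = 0])
      (use theta_factor_bound[OF assms, of z E] in \<open>auto simp: E_def\<close>)
  then show ?thesis
    by (intro abs_convergent_prod_imp_convergent_prod summable_imp_abs_convergent_prod)
qed

text \<open>Uniformity on discs is what carries convergence over to derivatives. The M-test for the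
  sum of |factor - 1| yields uniform convergence of the products.\<close>

lemma theta_partial_uniform_limit:
  assumes "norm (e \<tau>) < 1"
  shows "uniform_limit (cball z r) (theta_partial \<tau>) (\<lambda>w. theta w \<tau>) sequentially"
proof -
  define q where "q = e \<tau>"
  have q: "norm q < 1" using assms by (simp add: q_def)
  let ?K = "cball z r"
  define R where "R = norm z + \<bar>r\<bar>"
  \<comment> \<open>On the disc |Im w| <= R, and |e(w)| = exp(-2 pi Im w), so E bounds both e(w) and
    e(-w).\<close>
  define E where "E = exp (2 * pi * R)"
  have "R \<ge> 0" by (simp add: R_def)
  then have "E \<ge> 1" by (simp add: E_def)
  have E: "norm (e w) \<le> E" "norm (e (- w)) \<le> E" if "w \<in> ?K" for w
  proof -
    have "norm w \<le> norm z + dist z w"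
      by (metis dist_norm norm_triangle_sub add.commute norm_minus_commute)
    then have "\<bar>Im w\<bar> \<le> R" using abs_Im_le_cmod[of w] that by (simp add: R_def)
    then have "pi * \<bar>Im w\<bar> \<le> pi * R" by (intro mult_left_mono) auto
    moreover have "\<bar>pi * Im w\<bar> = pi * \<bar>Im w\<bar>" by (simp add: abs_mult)
    ultimately have "\<bar>pi * Im w\<bar> \<le> pi * R" by simp
    then show "norm (e w) \<le> E" "norm (e (- w)) \<le> E"
      by (auto simp: norm_e E_def abs_le_iff mult.commute)
  qed
  have cont: "continuous_on A (theta_factor q m)" for m A
    unfolding theta_factor_def by (intro continuous_intros)
  have "uniform_limit ?K (\<lambda>N w. \<Sum>m<N. norm (theta_factor q m w - 1))
     (\<lambda>w. \<Sum>m. norm (theta_factor q m w - 1)) sequentially"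
    by (rule Weierstrass_m_test[where M = "\<lambda>m. E * ((1 + E)\<^sup>2 + (1 + E) + 1) * norm q ^ m"])
      (use theta_factor_bound[OF q E \<open>E \<ge> 1\<close>] q in \<open>auto intro!: summable_mult summable_geometric\<close>)
  then have uc: "uniformly_convergent_on ?K (\<lambda>N w. \<Prod>m<N. theta_factor q m w)"
    by (intro uniformly_convergent_on_prod' cont) (auto simp: uniformly_convergent_on_def)
  then obtain l where l: "uniform_limit ?K (\<lambda>N w. \<Prod>m<N. theta_factor q m w) l sequentially"
    by (auto simp: uniformly_convergent_on_def)
  \<comment> \<open>So far the uniform limit is just some function; pointwise convergence identifies
    it with the infinite product.\<close>
  have "l w = (\<Prod>m. theta_factor q m w)" if "w \<in> ?K" for w
    using tendsto_uniform_limitI[OF l that]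
      convergent_prod_LIMSEQ[OF theta_factor_convergent_prod[OF q], of w]
    by (auto simp: LIMSEQ_lessThan_iff_atMost intro: LIMSEQ_unique)
  then have lim: "uniform_limit ?K (\<lambda>N w. \<Prod>m<N. theta_factor q m w) (\<lambda>w. \<Prod>m. theta_factor q m w) sequentially"
    using l by (subst uniform_limit_cong'[where h = "\<lambda>w. \<Prod>m. theta_factor q m w" and i = l]) auto
  \<comment> \<open>Multiplying uniform limits calls for bounded limit functions; continuity on the
    compact disc provides this.\<close>
  have "continuous_on ?K (\<lambda>w. \<Prod>m. theta_factor q m w)"
    by (rule uniform_limit_theorem[OF _ lim]) (auto intro!: always_eventually continuous_intros cont)
  then have "bounded ((\<lambda>w. \<Prod>m. theta_factor q m w) ` ?K)"
    by (intro compact_imp_bounded compact_continuous_image) auto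
  moreover have "bounded ((\<lambda>w. 2 * e (\<tau> / 8) * sin (of_real pi * w)) ` ?K)"
    by (intro compact_imp_bounded compact_continuous_image continuous_intros) auto
  ultimately show ?thesis
    unfolding theta_partial_def theta_eq q_def[symmetric]
    by (intro uniform_lim_mult lim uniform_limit_const)
qed

lemma theta_partial_holomorphic: "theta_partial \<tau> N holomorphic_on A"
proof -
  have "e holomorphic_on B" for B unfolding e_def[abs_def] by (intro holomorphic_intros)
  moreover have "(\<lambda>z. e (- z)) holomorphic_on B" for B unfolding e_def[abs_def] by (intro holomorphic_intros)
  ultimately show ?thesis
    unfolding theta_partial_def theta_factor_def by (intro holomorphic_intros)
qed

text \<open>Locally uniform convergence of holomorphic functions passes to all derivatives; k = 0,
  1, 2 are the cases of interest.\<close>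

lemma theta_partial_higher_deriv_LIMSEQ:
  assumes "norm (e \<tau>) < 1"
  shows "(\<lambda>N. (deriv ^^ k) (theta_partial \<tau> N) z) \<longlonglongrightarrow> (deriv ^^ k) (\<lambda>w. theta w \<tau>) z"
  by (rule higher_deriv_complex_uniform_limit[where A = "ball z 1"])
    (auto intro: uniform_limit_on_subset[OF theta_partial_uniform_limit[OF assms, of z 1]]
      always_eventually theta_partial_holomorphic)

section \<open>Logarithmic derivatives of theta\<close>

lemma pole_sum_Suc:
  "pole_sum q x (Suc N) = pole_sum q x N + pole q x (int N + 1) + pole q x (- int N - 1) - 1"
proof -
  have "{- int (Suc N)..int (Suc N)} = insert (int N + 1) (insert (- int N - 1) {- int N..int N})"
    by auto
  then show ?thesis by (simp add: pole_sum_def)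
qed

text \<open>This is pi cot(pi z) = 2 pi i (1/(1 - e(-z)) - 1/2), cleared of the division by the
  sine.\<close>

lemma sin_pi_deriv_eq:
  assumes "e (- z) \<noteq> 1"
  shows "of_real pi * cos (of_real pi * z) =
    sin (of_real pi * z) * (2 * of_real pi * \<i> * (1 / (1 - e (- z)) - 1 / 2))"
proof -
  define E where "E = exp (\<i> * (of_real pi * z))"
  have E: "E \<noteq> 0" by (simp add: E_def)
  have ez: "e (- z) = 1 / (E * E)"
    unfolding e_def E_def by (simp add: field_simps flip: exp_add)
  have "E * E \<noteq> 1" using assms ez by auto
  have s: "sin (of_real pi * z) = (E - 1 / E) / (2 * \<i>)" "cos (of_real pi * z) = (E + 1 / E) / 2"
    by (simp_all add: sin_exp_eq cos_exp_eq E_def exp_minus inverse_eq_divide)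
  show ?thesis unfolding s ez using E \<open>E * E \<noteq> 1\<close>
    by (simp add: divide_simps) (simp add: algebra_simps)
qed

text \<open>The factor with e(-z) contributes the pole term at m + 1 less 1, the factor with e(z)
  the pole term at -m - 1.\<close>

lemma theta_factor_deriv:
  assumes "nome_annulus q (e (- z))"
  shows "(theta_factor q m has_field_derivative theta_factor q m z *
    (2 * of_real pi * \<i> * (pole q (e (- z)) (int m + 1) + pole q (e (- z)) (- int m - 1) - 1))) (at z)"
proof -
  interpret nome_annulus q "e (- z)" by fact
  define x p where "x = e (- z)" and "p = q ^ Suc m"
  have x: "x \<noteq> 0" "e z = 1 / x" using e_minus[of z] by (simp_all add: x_def)
  have p: "p \<noteq> 0" using q_nz by (simp add: p_def)
  have pm: "q powi (int m + 1) = p" unfolding p_def by (metis Suc_eq_plus1 of_nat_1 of_nat_add power_int_of_nat)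
  then have mp: "q powi (- int m - 1) = 1 / p"
    using power_int_minus[of q "int m + 1"] by (simp add: inverse_eq_divide)
  have ne: "x * p \<noteq> 1" "x \<noteq> p" 
    using ne_1[of "int m + 1"] ne_1[of "- int m - 1"] p pm mp by (auto simp: x_def)
  have "((\<lambda>z. (1 - p) * (1 - e z * p) * (1 - e (- z) * p)) has_field_derivative
     (1 - p) * (- 2 * of_real pi * \<i> * e z * p * (1 - e (- z) * p) + (1 - e z * p) * (2 * of_real pi * \<i> * e (- z) * p))) (at z)"
    by (auto intro!: derivative_eq_intros simp: algebra_simps)
  also have "(1 - p) * (- 2 * of_real pi * \<i> * e z * p * (1 - e (- z) * p) + (1 - e z * p) * (2 * of_real pi * \<i> * e (- z) * p))
    = (1 - p) * (1 - e z * p) * (1 - e (- z) * p) *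
      (2 * of_real pi * \<i> * (pole q (e (- z)) (int m + 1) + pole q (e (- z)) (- int m - 1) - 1))"
    unfolding pole_def pm mp unfolding x(2) x_def[symmetric]
    using x(1) p ne by (simp add: divide_simps) (simp add: algebra_simps)
  finally show ?thesis unfolding theta_factor_def[abs_def] p_def .
qed

text \<open>Logarithmic derivatives add under multiplication; the sine is the base case.\<close>

lemma theta_partial_deriv:
  assumes "nome_annulus (e \<tau>) (e (- z))"
  shows "(theta_partial \<tau> N has_field_derivative theta_partial \<tau> N z *
    (2 * of_real pi * \<i> * pole_sum (e \<tau>) (e (- z)) N)) (at z)"
proof (induction N)
  case 0
  have "e (- z) \<noteq> 1" using assms by (rule nome_annulus.x_ne_1)
  have "((\<lambda>z. sin (of_real pi * z)) has_field_derivative of_real pi * cos (of_real pi * z)) (at z)"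
    by (auto intro!: derivative_eq_intros)
  then have "((\<lambda>z. 2 * e (\<tau> / 8) * sin (of_real pi * z)) has_field_derivative
      2 * e (\<tau> / 8) * (of_real pi * cos (of_real pi * z))) (at z)"
    by (rule DERIV_cmult)
  then show ?case
    unfolding sin_pi_deriv_eq[OF \<open>e (- z) \<noteq> 1\<close>]
    by (simp add: theta_partial_def[abs_def] pole_sum_def pole_def)
next
  case (Suc N)
  have "theta_partial \<tau> (Suc N) = (\<lambda>z. theta_partial \<tau> N z * theta_factor (e \<tau>) N z)"
    by (simp add: theta_partial_def fun_eq_iff)
  moreover have "((\<lambda>z. theta_partial \<tau> N z * theta_factor (e \<tau>) N z) has_field_derivative
     theta_partial \<tau> N z * theta_factor (e \<tau>) N z * (2 * of_real pi * \<i> * pole_sum (e \<tau>) (e (- z)) (Suc N))) (at z)"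
    using DERIV_mult[OF Suc.IH theta_factor_deriv[OF assms, of N]]
    by (simp add: pole_sum_Suc algebra_simps)
  ultimately show ?case by simp
qed

text \<open>As x = e(-z), d/dz equals -2 pi i times x d/dx, whence the sign.\<close>

lemma pole_sum_deriv:
  assumes "nome_annulus q (e (- z))"
  shows "((\<lambda>z. pole_sum q (e (- z)) N) has_field_derivative
    - (2 * of_real pi * \<i> * pole_deriv_sum q (e (- z)) N)) (at z)"
proof -
  interpret nome_annulus q "e (- z)" by fact
  have "((\<lambda>z. pole q (e (- z)) m - 1 / 2) has_field_derivative
     - (2 * of_real pi * \<i> * ((pole q (e (- z)) m)\<^sup>2 - pole q (e (- z)) m))) (at z)" for m
  proof -
    define p where "p = q powi m"
    have ne: "e (- z) * p \<noteq> 1" using ne_1[of m] by (simp add: p_def)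
    then have "((\<lambda>z. 1 / (1 - e (- z) * p) - 1 / 2) has_field_derivative
        - (2 * of_real pi * \<i> * (e (- z) * p)) / (1 - e (- z) * p)\<^sup>2) (at z)"
      by (auto intro!: derivative_eq_intros simp: power2_eq_square)
    also have "- (2 * of_real pi * \<i> * (e (- z) * p)) / (1 - e (- z) * p)\<^sup>2 =
        - (2 * of_real pi * \<i> * ((1 / (1 - e (- z) * p))\<^sup>2 - 1 / (1 - e (- z) * p)))"
      using ne by (simp add: divide_simps power2_eq_square)
    finally show ?thesis unfolding pole_def p_def .
  qed
  then have "((\<lambda>z. pole_sum q (e (- z)) N) has_field_derivative
    (\<Sum>m = - int N..int N. - (2 * of_real pi * \<i> * ((pole q (e (- z)) m)\<^sup>2 - pole q (e (- z)) m)))) (at z)"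
    unfolding pole_sum_def by (intro DERIV_sum)
  then show ?thesis
    by (simp only: pole_deriv_sum_def sum_negf sum_distrib_left)
qed

text \<open>Openness makes the formula for the first derivative valid near z, so that it can be
  differentiated again.\<close>

lemma open_nome_annulus: "open {z. nome_annulus q (e (- z))}"
proof -
  have "{z. nome_annulus q (e (- z))} = 
    (if q = 0 then {} else {z. e (- z) \<noteq> 1} \<inter> {z. norm (e (- z) * q) < 1} \<inter> {z. norm (q / e (- z)) < 1})"
    by (auto simp: nome_annulus_def)
  then show ?thesis
    by (auto intro!: open_Int open_Collect_neq open_Collect_less continuous_intros)
qed

text \<open>With c = 2 pi i, P' = c P S and S' = -c D S give P'' = c^2 P (S^2 - D S).\<close>

lemma theta_partial_deriv2:
  assumes "nome_annulus (e \<tau>) (e (- z))"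
  shows "(deriv ^^ 2) (theta_partial \<tau> N) z = theta_partial \<tau> N z *
    ((2 * of_real pi * \<i>)\<^sup>2 * ((pole_sum (e \<tau>) (e (- z)) N)\<^sup>2 - pole_deriv_sum (e \<tau>) (e (- z)) N))"
proof -
  have "eventually (\<lambda>w. w \<in> {z. nome_annulus (e \<tau>) (e (- z))}) (nhds z)"
    using open_nome_annulus assms by (intro eventually_nhds_in_open) auto
  then have "eventually (\<lambda>w. deriv (theta_partial \<tau> N) w =
      theta_partial \<tau> N w * (2 * of_real pi * \<i> * pole_sum (e \<tau>) (e (- w)) N)) (nhds z)"
    by eventually_elim (auto intro!: DERIV_imp_deriv theta_partial_deriv)
  then have "deriv (deriv (theta_partial \<tau> N)) z =
     deriv (\<lambda>w. theta_partial \<tau> N w * (2 * of_real pi * \<i> * pole_sum (e \<tau>) (e (- w)) N)) z"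
    by (intro deriv_cong_ev) auto
  also have "\<dots> = theta_partial \<tau> N z *
    ((2 * of_real pi * \<i>)\<^sup>2 * ((pole_sum (e \<tau>) (e (- z)) N)\<^sup>2 - pole_deriv_sum (e \<tau>) (e (- z)) N))"
    using DERIV_mult[OF theta_partial_deriv[OF assms, of N] DERIV_cmult[OF pole_sum_deriv[OF assms, of N], of "2 * of_real pi * \<i>"]]
    by (intro DERIV_imp_deriv) (simp add: power2_eq_square algebra_simps)
  finally show ?thesis by (simp add: numeral_2_eq_2)
qed

text \<open>A convergent product of nonzero factors is nonzero. The factors vanish only where some x
  q^m = 1 with m nonzero, the sine only where x = 1, and the annulus excludes both.\<close>

lemma theta_nonzero:
  assumes "nome_annulus (e \<tau>) (e (- z))"
  shows "theta z \<tau> \<noteq> 0"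
proof -
  interpret nome_annulus "e \<tau>" "e (- z)" by fact
  have "theta_factor (e \<tau>) m z \<noteq> 0" for m
  proof -
    have "e (- z) * e \<tau> ^ Suc m \<noteq> 1"
      using ne_1[of "int (Suc m)"] by (simp only: power_int_of_nat) simp
    moreover have "e z * e \<tau> ^ Suc m \<noteq> 1"
      using nome_annulus.ne_1[OF reciprocal, of "int (Suc m)"] e_minus[of "- z"]
      by (simp only: power_int_of_nat) simp
    moreover have "e \<tau> ^ Suc m \<noteq> 1"
      using power_int_ne_1[OF q_nz norm_q_less_1, of "int (Suc m)"] by (simp only: power_int_of_nat) simp
    ultimately show ?thesis by (simp add: theta_factor_def)
  qed
  then have "(\<Prod>m. theta_factor (e \<tau>) m z) \<noteq> 0"
    by (intro prodinf_nonzero theta_factor_convergent_prod norm_q_less_1)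
  moreover have "sin (of_real pi * z) \<noteq> 0"
  proof
    assume "sin (of_real pi * z) = 0"
    then obtain n where "of_real pi * z = of_int n * of_real pi"
      by (auto simp: sin_eq_0)
    then have "- z = of_int (- n)" by simp
    then have "e (- z) = 1" unfolding e_eq_1_iff by (metis Ints_of_int)
    then show False using x_ne_1 by contradiction
  qed
  ultimately show ?thesis by (simp add: theta_eq)
qed

text \<open>One sequence is given two limits: through the partial products, and through the sum of
  \<open>rest\<close>.\<close>

lemma theta_log_deriv:
  assumes "nome_annulus (e \<tau>) (e (- z))"
  shows "theta' z \<tau> / theta z \<tau> = 2 * of_real pi * \<i> * (rest_sum (e \<tau>) (e (- z)) - 1 / 2)"
proof (rule LIMSEQ_unique)
  interpret nome_annulus "e \<tau>" "e (- z)" by fact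
  have 0: "(\<lambda>N. theta_partial \<tau> N z) \<longlonglongrightarrow> theta z \<tau>"
    using theta_partial_higher_deriv_LIMSEQ[OF norm_q_less_1, of 0 z] by simp
  have 1: "(\<lambda>N. deriv (theta_partial \<tau> N) z) \<longlonglongrightarrow> theta' z \<tau>"
    using theta_partial_higher_deriv_LIMSEQ[OF norm_q_less_1, of 1 z] by (simp add: theta'_def)
  have nz: "eventually (\<lambda>N. theta_partial \<tau> N z \<noteq> 0) sequentially"
    using tendsto_imp_eventually_ne[OF 0 theta_nonzero[OF assms]] .
  show "(\<lambda>N. 2 * of_real pi * \<i> * pole_sum (e \<tau>) (e (- z)) N) \<longlonglongrightarrow> theta' z \<tau> / theta z \<tau>"
    by (rule Lim_transform_eventually[OF tendsto_divide[OF 1 0 theta_nonzero[OF assms]]], use nz in eventually_elim)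
      (simp add: DERIV_imp_deriv[OF theta_partial_deriv[OF assms]])
  show "(\<lambda>N. 2 * of_real pi * \<i> * pole_sum (e \<tau>) (e (- z)) N) \<longlonglongrightarrow> 2 * of_real pi * \<i> * (rest_sum (e \<tau>) (e (- z)) - 1 / 2)"
    by (intro tendsto_mult_left pole_sum_LIMSEQ rest_has_sum)
qed

lemma theta_second_deriv_LIMSEQ:
  assumes "nome_annulus (e \<tau>) (e (- z))"
  shows "(\<lambda>N. (2 * of_real pi * \<i>)\<^sup>2 * ((pole_sum (e \<tau>) (e (- z)) N)\<^sup>2 - pole_deriv_sum (e \<tau>) (e (- z)) N))
    \<longlonglongrightarrow> theta'' z \<tau> / theta z \<tau>"
proof -
  interpret nome_annulus "e \<tau>" "e (- z)" by fact
  have 0: "(\<lambda>N. theta_partial \<tau> N z) \<longlonglongrightarrow> theta z \<tau>"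
    using theta_partial_higher_deriv_LIMSEQ[OF norm_q_less_1, of 0 z] by simp
  have 2: "(\<lambda>N. (deriv ^^ 2) (theta_partial \<tau> N) z) \<longlonglongrightarrow> theta'' z \<tau>"
    using theta_partial_higher_deriv_LIMSEQ[OF norm_q_less_1, of 2 z]
    by (simp add: theta''_def theta'_def[abs_def] numeral_2_eq_2)
  have nz: "eventually (\<lambda>N. theta_partial \<tau> N z \<noteq> 0) sequentially"
    using tendsto_imp_eventually_ne[OF 0 theta_nonzero[OF assms]] .
  show ?thesis
    by (rule Lim_transform_eventually[OF tendsto_divide[OF 2 0 theta_nonzero[OF assms]]], use nz in eventually_elim)
      (simp add: theta_partial_deriv2[OF assms])
qed

text \<open>Subtracting \<open>pole_norm_const\<close> at both points leaves the difference
  unchanged and gives each part a limit of its own.\<close>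

lemma theta_second_deriv_diff:
  assumes "nome_annulus (e \<tau>) (e (- z))" "nome_annulus (e \<tau>) (e (- w))"
  shows "theta'' z \<tau> / theta z \<tau> - theta'' w \<tau> / theta w \<tau> =
    2 * (2 * of_real pi * \<i>)\<^sup>2 * (rest_moment (e \<tau>) (e (- w)) - rest_moment (e \<tau>) (e (- z)))"
proof (rule LIMSEQ_unique)
  let ?S = "\<lambda>z N. (pole_sum (e \<tau>) (e (- z)) N)\<^sup>2 - pole_deriv_sum (e \<tau>) (e (- z)) N"
  let ?D = "\<lambda>N. (2 * of_real pi * \<i>)\<^sup>2 * ?S z N - (2 * of_real pi * \<i>)\<^sup>2 * ?S w N"
  show "?D \<longlonglongrightarrow> theta'' z \<tau> / theta z \<tau> - theta'' w \<tau> / theta w \<tau>"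
    by (intro tendsto_diff theta_second_deriv_LIMSEQ assms)
  have lim: "(\<lambda>N. ?S z N - pole_norm_const (e \<tau>) N) \<longlonglongrightarrow> - 2 * rest_moment (e \<tau>) (e (- z))"
    if "nome_annulus (e \<tau>) (e (- z))" for z
    by (rule nome_annulus.pole_sum_square_LIMSEQ[OF that nome_annulus.rest_moment_has_sum[OF that]])
  have "(\<lambda>N. (2 * of_real pi * \<i>)\<^sup>2 * ((?S z N - pole_norm_const (e \<tau>) N) - (?S w N - pole_norm_const (e \<tau>) N)))
    \<longlonglongrightarrow> (2 * of_real pi * \<i>)\<^sup>2 * (- 2 * rest_moment (e \<tau>) (e (- z)) - - 2 * rest_moment (e \<tau>) (e (- w)))"
    by (intro tendsto_mult_left tendsto_diff lim assms)
  then show "?D \<longlonglongrightarrow> 2 * (2 * of_real pi * \<i>)\<^sup>2 * (rest_moment (e \<tau>) (e (- w)) - rest_moment (e \<tau>) (e (- z)))"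
    by (simp add: algebra_simps)
qed

section \<open>The identity for large Im \<tau>\<close>

lemma nome_annulus_e:
  assumes "\<alpha> \<notin> \<int>" "Im \<tau> > \<bar>Im \<alpha>\<bar>"
  shows "nome_annulus (e \<tau>) (e \<alpha>)"
proof
  have "e \<alpha> * e \<tau> = e (\<alpha> + \<tau>)" "e \<tau> / e \<alpha> = e (\<tau> + - \<alpha>)"
    by (simp_all only: e_add e_minus times_divide_eq_right mult_1_right)
  then show "norm (e \<alpha> * e \<tau>) < 1" "norm (e \<tau> / e \<alpha>) < 1"
    using assms(2) by (auto simp: norm_e zero_less_mult_iff mult_less_0_iff)
qed (use assms in \<open>simp_all add: e_eq_1_iff\<close>)

theorem proposition1p2:
  fixes \<alpha>1 \<alpha>2 \<alpha>3 \<alpha>4 :: complex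
  assumes "\<alpha>1 \<notin> \<int>" and "\<alpha>2 \<notin> \<int>" and "\<alpha>3 \<notin> \<int>" and "\<alpha>4 \<notin> \<int>"
  shows "\<exists>T::real. \<forall>(k::int) (\<tau>::complex). Im \<tau> > 0 \<and> Im \<tau> > T \<longrightarrow>
    ((\<lambda>(a::int, b::int).
        ((1 - e (\<alpha>3 + \<alpha>4)) * (1 - e (\<alpha>1 + \<alpha>2) * nome \<tau> powi (k * a))) /
        ((1 - e \<alpha>4 * nome \<tau> powi a) * (1 - e \<alpha>1 * nome \<tau> powi b) *
         (1 - e \<alpha>3 * nome \<tau> powi (- a)) * (1 - e \<alpha>2 * nome \<tau> powi (k * a - b))))
      has_sum
      (1 / (2 * of_real pi * \<i>)\<^sup>2 *
        ((theta' (- \<alpha>3) \<tau> / theta (- \<alpha>3) \<tau> + theta' (- \<alpha>4) \<tau> / theta (- \<alpha>4) \<tau>) *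
         (theta' (- \<alpha>1) \<tau> / theta (- \<alpha>1) \<tau> + theta' (- \<alpha>2) \<tau> / theta (- \<alpha>2) \<tau>) +
         of_int k / 2 *
           (theta'' (- \<alpha>3) \<tau> / theta (- \<alpha>3) \<tau> - theta'' (- \<alpha>4) \<tau> / theta (- \<alpha>4) \<tau>))))
     UNIV"
proof (intro exI allI impI)
  fix k :: int and \<tau> :: complex
  \<comment> \<open>The threshold T is the largest |Im \<alpha>i|, uniformly in k.\<close>
  assume \<tau>: "Im \<tau> > 0 \<and> Im \<tau> > max (max \<bar>Im \<alpha>1\<bar> \<bar>Im \<alpha>2\<bar>) (max \<bar>Im \<alpha>3\<bar> \<bar>Im \<alpha>4\<bar>)"
  define q where "q = e \<tau>"
  have ann: "nome_annulus q (e \<alpha>1)" "nome_annulus q (e \<alpha>2)" "nome_annulus q (e \<alpha>3)" "nome_annulus q (e \<alpha>4)"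
    unfolding q_def using \<tau> assms by (auto intro!: nome_annulus_e)
  \<comment> \<open>\<alpha>4 comes first because its denominator carries q^a, while that of
    \<alpha>3 carries q^(0 - a).\<close>
  interpret U: nome_annulus_pair q "e \<alpha>4" "e \<alpha>3" by (intro nome_annulus_pair.intro ann)
  interpret X: nome_annulus_pair q "e \<alpha>1" "e \<alpha>2" by (intro nome_annulus_pair.intro ann)
  define c :: complex where "c = 2 * of_real pi * \<i>"
  have "c \<noteq> 0" by (simp add: c_def)
  have log: "theta' (- \<alpha>) \<tau> / theta (- \<alpha>) \<tau> = c * (rest_sum q (e \<alpha>) - 1 / 2)" if "nome_annulus q (e \<alpha>)" for \<alpha>
    using theta_log_deriv[of \<tau> "- \<alpha>"] that by (simp add: q_def c_def)
  have diff: "theta'' (- \<alpha>3) \<tau> / theta (- \<alpha>3) \<tau> - theta'' (- \<alpha>4) \<tau> / theta (- \<alpha>4) \<tau> =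
      2 * c\<^sup>2 * (rest_moment q (e \<alpha>4) - rest_moment q (e \<alpha>3))"
    using theta_second_deriv_diff[of \<tau> "- \<alpha>3" "- \<alpha>4"] ann by (simp add: q_def c_def)
  \<comment> \<open>The powers of c cancel, and the two halves in each bracket combine to the -1 of
    \<open>pole_pair_double_sum\<close>.\<close>
  have "1 / c\<^sup>2 * ((c * (rest_sum q (e \<alpha>3) - 1 / 2) + c * (rest_sum q (e \<alpha>4) - 1 / 2)) *
      (c * (rest_sum q (e \<alpha>1) - 1 / 2) + c * (rest_sum q (e \<alpha>2) - 1 / 2)) +
      of_int k / 2 * (2 * c\<^sup>2 * (rest_moment q (e \<alpha>4) - rest_moment q (e \<alpha>3)))) =
    (rest_sum q (e \<alpha>4) + rest_sum q (e \<alpha>3) - 1) * (rest_sum q (e \<alpha>1) + rest_sum q (e \<alpha>2) - 1)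
     + of_int k * (rest_moment q (e \<alpha>4) - rest_moment q (e \<alpha>3))"
    using \<open>c \<noteq> 0\<close> by (simp add: field_simps power2_eq_square)
  moreover have "((1 - e (\<alpha>3 + \<alpha>4)) * (1 - e (\<alpha>1 + \<alpha>2) * q powi (k * a))) /
        ((1 - e \<alpha>4 * q powi a) * (1 - e \<alpha>1 * q powi b) *
         (1 - e \<alpha>3 * q powi (- a)) * (1 - e \<alpha>2 * q powi (k * a - b)))
     = pole_pair q (e \<alpha>4) (e \<alpha>3) 0 a * pole_pair q (e \<alpha>1) (e \<alpha>2) (k * a) b" for a b
    unfolding U.pole_pair_eq X.pole_pair_eq by (simp add: e_add mult_ac)
  ultimately show "((\<lambda>(a::int, b::int).
        ((1 - e (\<alpha>3 + \<alpha>4)) * (1 - e (\<alpha>1 + \<alpha>2) * nome \<tau> powi (k * a))) /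
        ((1 - e \<alpha>4 * nome \<tau> powi a) * (1 - e \<alpha>1 * nome \<tau> powi b) *
         (1 - e \<alpha>3 * nome \<tau> powi (- a)) * (1 - e \<alpha>2 * nome \<tau> powi (k * a - b))))
      has_sum
      (1 / (2 * of_real pi * \<i>)\<^sup>2 *
        ((theta' (- \<alpha>3) \<tau> / theta (- \<alpha>3) \<tau> + theta' (- \<alpha>4) \<tau> / theta (- \<alpha>4) \<tau>) *
         (theta' (- \<alpha>1) \<tau> / theta (- \<alpha>1) \<tau> + theta' (- \<alpha>2) \<tau> / theta (- \<alpha>2) \<tau>) +
         of_int k / 2 *
           (theta'' (- \<alpha>3) \<tau> / theta (- \<alpha>3) \<tau> - theta'' (- \<alpha>4) \<tau> / theta (- \<alpha>4) \<tau>))))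
     UNIV"
    using pole_pair_double_sum[OF U.nome_annulus_pair_axioms X.nome_annulus_pair_axioms, of k]
    unfolding diff log[OF ann(1)] log[OF ann(2)] log[OF ann(3)] log[OF ann(4)] nome_def
      q_def[symmetric] c_def[symmetric]
    by simp
qed

end
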